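(* Let $f\in\mathcal A$, $N\in[1,\infty)$, and $\tilde Lu=f^2Lu-\frac{N-2}2\Gamma(f^2,u)$, with associated $N$-Ricci tensor $\tilde R_N$. Then for all $u\in\mathcal A$, pointwise on $X$, $$\tilde R_N(u)\ge f^4R_N(u)+\Big(\frac12f^2Lf^2-\frac N4\Gamma(f^2)\Big)\Gamma(u)-\frac{N-2}4\Gamma(f^2,u)^2+\frac{N-2}2f^2H_{f^2}(u,u).$$ In particular, if $L$ satisfies the $\mathrm{BE}(k,N)$-condition for some $k:X\to\mathbb R$, then $\tilde L$ satisfies the $\mathrm{BE}(\tilde k,N)$-condition with $$\begin{aligned}\tilde k&=f^2k+\frac12Lf^2-N\Gamma(f)+\inf_{u\in\mathcal A}\frac1{\Gamma(u)}\Big[-(N-2)\Gamma(f,u)^2+\frac{N-2}2H_{f^2}(u,u)\Big]\\&=f^2k+fLf-(N-1)\Gamma(f)+\inf_{u\in\mathcal A}\frac{N-2}{\Gamma(u)}f\,H_f(u,u),\end{aligned}$$ where at each $x\in X$ the infima are over those $u\in\mathcal A$ with $\Gamma(u)(x)>0$.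
   Context: Let $X$ be a set, $\mathcal A$ an algebra of real-valued functions on $X$ and $L:\mathcal A\to\mathcal A$ a linear operator. Put $\Gamma(f,g)=\frac12[L(fg)-fLg-gLf]$ and $\Gamma(f)=\Gamma(f,f)$. $L$ is assumed to be a diffusion operator: $\Gamma(f)\ge0$ for all $f\in\mathcal A$, and for all $r$, all $f_1,\dots,f_r\in\mathcal A$ and every $C^\infty$ function $\psi:\mathbb R^r\to\mathbb R$ with $\psi(0)=0$ one has $\psi(f_1,\dots,f_r)\in\mathcal A$ and $L\psi(f_1,\dots,f_r)=\sum_i\psi_i(f_1,\dots,f_r)\,Lf_i+\sum_{i,j}\psi_{ij}(f_1,\dots,f_r)\,\Gamma(f_i,f_j)$, where $\psi_i,\psi_{ij}$ are partial derivatives. $L,\Gamma$ are extended to the algebra generated by $\mathcal A$ and the constants by $L1=0$, $\Gamma(1,f)=0$. Define $\Gamma_2(f,g)=\frac12[L\Gamma(f,g)-\Gamma(f,Lg)-\Gamma(g,Lf)]$, $\Gamma_2(f)=\Gamma_2(f,f)$, the Hessian $H_f(g,h)=\frac12[\Gamma(g,\Gamma(f,h))+\Gamma(h,\Gamma(f,g))-\Gamma(f,\Gamma(g,h))]$, and for $N\in[1,\infty]$ the $N$-Ricci tensor $R_N(f)(x)=\inf\{\Gamma_2(\tilde f)(x)-\frac1N(L\tilde f)^2(x):\tilde f\in\mathcal A,\ \Gamma(\tilde f-f)(x)=0\}\in[-\infty,\infty)$. $\tilde\Gamma,\tilde\Gamma_2,\tilde R_N$ are defined by the same formulas with $\tilde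 L$ in place of $L$. Bakry–Émery condition: $L$ satisfies $\mathrm{BE}(k,N)$ if $\Gamma_2(u)(x)\ge k(x)\Gamma(u)(x)+\frac1N(Lu)^2(x)$ for all $u\in\mathcal A$, $x\in X$; for $\tilde L$ the condition is formed with $\tilde\Gamma,\tilde\Gamma_2$. Convention: $0\cdot(\pm\infty)=0$. *)

theory Defs
  imports "HOL-Analysis.Analysis"
begin

text \<open>\<open>\<real>\<^sup>r\<close> with variable \<open>r\<close> is \<^const>\<open>Euclidean_space\<close> \<open>r\<close>: the sequences vanishing at all
  indices \<open>i \<ge> r\<close>, so the coordinates are \<open>x 0, \<dots>, x (r - 1)\<close>.  Below, the values of
  \<open>\<psi>\<close> outside this set are never relevant.\<close>

definition partial_deriv :: "nat \<Rightarrow> ((nat \<Rightarrow> real) \<Rightarrow> real) \<Rightarrow> (nat \<Rightarrow> real) \<Rightarrow> real" where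
  "partial_deriv i \<psi> x = deriv (\<lambda>t. \<psi> (x(i := t))) (x i)"

primrec Ck_on_Rn :: "nat \<Rightarrow> nat \<Rightarrow> ((nat \<Rightarrow> real) \<Rightarrow> real) \<Rightarrow> bool" where
  "Ck_on_Rn 0 r \<psi> \<longleftrightarrow> continuous_map (Euclidean_space r) euclideanreal \<psi>"
| "Ck_on_Rn (Suc k) r \<psi> \<longleftrightarrow>
     continuous_map (Euclidean_space r) euclideanreal \<psi> \<and>
     (\<forall>i<r. (\<forall>x \<in> topspace (Euclidean_space r).
                (\<lambda>t. \<psi> (x(i := t))) field_differentiable at (x i)) \<and>
            Ck_on_Rn k r (partial_deriv i \<psi>))"

definition Cinf_on_Rn :: "nat \<Rightarrow> ((nat \<Rightarrow> real) \<Rightarrow> real) \<Rightarrow> bool" where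
  "Cinf_on_Rn r \<psi> \<longleftrightarrow> (\<forall>k. Ck_on_Rn k r \<psi>)"

definition tuple_map :: "nat \<Rightarrow> (nat \<Rightarrow> 'a \<Rightarrow> real) \<Rightarrow> 'a \<Rightarrow> nat \<Rightarrow> real" where
  "tuple_map r fs x = (\<lambda>i. if i < r then fs i x else 0)"

definition Gam :: "(('a \<Rightarrow> real) \<Rightarrow> 'a \<Rightarrow> real) \<Rightarrow> ('a \<Rightarrow> real) \<Rightarrow> ('a \<Rightarrow> real) \<Rightarrow> 'a \<Rightarrow> real" where
  "Gam L f g = (\<lambda>x. 1/2 * (L (\<lambda>y. f y * g y) x - f x * L g x - g x * L f x))"

definition Gam2 :: "(('a \<Rightarrow> real) \<Rightarrow> 'a \<Rightarrow> real) \<Rightarrow> ('a \<Rightarrow> real) \<Rightarrow> ('a \<Rightarrow> real) \<Rightarrow> 'a \<Rightarrow> real" where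
  "Gam2 L f g = (\<lambda>x. 1/2 * (L (Gam L f g) x - Gam L f (L g) x - Gam L g (L f) x))"

definition Hess :: "(('a \<Rightarrow> real) \<Rightarrow> 'a \<Rightarrow> real) \<Rightarrow>
    ('a \<Rightarrow> real) \<Rightarrow> ('a \<Rightarrow> real) \<Rightarrow> ('a \<Rightarrow> real) \<Rightarrow> 'a \<Rightarrow> real" where
  "Hess L f g h = (\<lambda>x. 1/2 * (Gam L g (Gam L f h) x + Gam L h (Gam L f g) x
                               - Gam L f (Gam L g h) x))"

locale function_algebra =
  fixes A :: "('a \<Rightarrow> real) set"
  assumes zero_mem: "(\<lambda>x. 0) \<in> A"
    and add_mem: "f \<in> A \<Longrightarrow> g \<in> A \<Longrightarrow> (\<lambda>x. f x + g x) \<in> A"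
    and scale_mem: "f \<in> A \<Longrightarrow> (\<lambda>x. c * f x) \<in> A"
    and mult_mem: "f \<in> A \<Longrightarrow> g \<in> A \<Longrightarrow> (\<lambda>x. f x * g x) \<in> A"

text \<open>The constants need not belong to \<open>A\<close>; the extension of \<open>L\<close> to them by \<open>L 1 = 0\<close> plays
  no role below, because all functions \<open>L\<close> is applied to lie in \<open>A\<close>.\<close>

locale diffusion_operator = function_algebra A
  for A :: "('a \<Rightarrow> real) set" +
  fixes L :: "('a \<Rightarrow> real) \<Rightarrow> 'a \<Rightarrow> real"
  assumes L_mem: "f \<in> A \<Longrightarrow> L f \<in> A"
    and L_add: "f \<in> A \<Longrightarrow> g \<in> A \<Longrightarrow> L (\<lambda>x. f x + g x) = (\<lambda>x. L f x + L g x)"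
    and L_scale: "f \<in> A \<Longrightarrow> L (\<lambda>x. c * f x) = (\<lambda>x. c * L f x)"
    and Gam_nonneg: "f \<in> A \<Longrightarrow> 0 \<le> Gam L f f x"
    and comp_mem: "(\<And>i. i < r \<Longrightarrow> fs i \<in> A) \<Longrightarrow> Cinf_on_Rn r \<psi> \<Longrightarrow> \<psi> (\<lambda>i. 0) = 0 \<Longrightarrow>
          (\<lambda>x. \<psi> (tuple_map r fs x)) \<in> A"
    and chain_rule: "(\<And>i. i < r \<Longrightarrow> fs i \<in> A) \<Longrightarrow> Cinf_on_Rn r \<psi> \<Longrightarrow> \<psi> (\<lambda>i. 0) = 0 \<Longrightarrow>
          L (\<lambda>x. \<psi> (tuple_map r fs x)) =
          (\<lambda>x. (\<Sum>i<r. partial_deriv i \<psi> (tuple_map r fs x) * L (fs i) x)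
             + (\<Sum>i<r. \<Sum>j<r. partial_deriv j (partial_deriv i \<psi>) (tuple_map r fs x)
                                * Gam L (fs i) (fs j) x))"

definition Ricci :: "('a \<Rightarrow> real) set \<Rightarrow> (('a \<Rightarrow> real) \<Rightarrow> 'a \<Rightarrow> real) \<Rightarrow> real \<Rightarrow>
    ('a \<Rightarrow> real) \<Rightarrow> 'a \<Rightarrow> ereal" where
  "Ricci A L N f x =
     (INF g \<in> {g \<in> A. Gam L (\<lambda>y. g y - f y) (\<lambda>y. g y - f y) x = 0}.
        ereal (Gam2 L g g x - 1 / N * (L g x)\<^sup>2))"

text \<open>The curvature bound \<open>k\<close> is allowed to take the values \<open>\<plusminus>\<infinity>\<close>; in \<^typ>\<open>ereal\<close>,
  \<open>0 * (\<plusminus>\<infinity>) = 0\<close>.\<close>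

definition BE :: "('a \<Rightarrow> real) set \<Rightarrow> (('a \<Rightarrow> real) \<Rightarrow> 'a \<Rightarrow> real) \<Rightarrow> ('a \<Rightarrow> ereal) \<Rightarrow> real \<Rightarrow> bool" where
  "BE A L k N \<longleftrightarrow> (\<forall>u\<in>A. \<forall>x.
     ereal (Gam2 L u u x) \<ge> k x * ereal (Gam L u u x) + ereal (1 / N * (L u x)\<^sup>2))"

definition conformal :: "(('a \<Rightarrow> real) \<Rightarrow> 'a \<Rightarrow> real) \<Rightarrow> ('a \<Rightarrow> real) \<Rightarrow> real \<Rightarrow>
    ('a \<Rightarrow> real) \<Rightarrow> 'a \<Rightarrow> real" where
  "conformal L f N u = (\<lambda>x. (f x)\<^sup>2 * L u x - (N - 2) / 2 * Gam L (\<lambda>y. (f y)\<^sup>2) u x)"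

end

theory Submission
  imports Defs
begin

text \<open>Write \<open>w = f\<^sup>2\<close> and \<open>\<Gamma>(v)\<close> for \<open>\<Gamma>(v, v)\<close>.  The chain rule for the
  polynomial \<open>x\<^sub>0 x\<^sub>1 x\<^sub>2\<close> says that \<open>\<Gamma>\<close> is a derivation in each argument (\<open>Gam_mult_left\<close>); from
  there on the argument is algebra with a symmetric positive biderivation.  In particular the conformal operator has the carre
  du champ \<open>w \<Gamma>\<close> (\<open>Gam_conformal\<close>), and its iterated carre du champ at \<open>v\<close> is an explicit expression
  in \<open>L\<close> (\<open>Gam2_conformal\<close>).  Compared with the claimed lower bound, this expression has the
  surplus \<open>w \<Gamma>(w, \<Gamma>(v)) - (2/N) w Lv \<Gamma>(w, v) + \<dots>\<close>, which depends on the second derivatives of \<open>v\<close>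
  and has no sign.

  The surplus is absorbed by the infimum in the Ricci tensor.  At a point \<open>x\<close> one may replace
  \<open>v\<close> by \<open>v + s (v - v(x)) (w - w(x))\<close>: the correction vanishes to second order at \<open>x\<close>, so the gradient
  is unchanged, while \<open>L\<close> and \<open>\<Gamma>\<^sub>2\<close> change by explicit terms (\<open>quadratic_perturbation\<close>).  With
  \<open>s = 1 / (2 w(x))\<close> these changes, multiplied by \<open>w(x)\<^sup>2\<close>, equal the surplus exactly (\<open>optimal_perturbation\<close>).

  Where \<open>w(x) > 0\<close>, the competitors \<open>v\<close> in the conformal Ricci tensor of \<open>u\<close> share with \<open>u\<close> only the
  gradient at \<open>x\<close>,
  whereas the bound contains \<open>H\<^sub>w(u, u)\<close>; so one also needs that the Hessian is tensorial.  This is not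
  automatic from the algebraic axioms, but it follows whenever the Ricci tensor of \<open>u\<close> is not
  \<open>-\<infinity>\<close>, by letting \<open>s\<close> run through all reals in a similar perturbation
  (\<open>Hess_null_of_Ricci_finite\<close>, \<open>Hess_cong_of_Ricci_finite\<close>); where the Ricci tensor is \<open>-\<infinity>\<close> there
  is nothing to prove.  Where \<open>w(x) = 0\<close>, both sides are zero.

  The Bakry--Emery condition says that the Ricci tensor of \<open>u\<close> is at least \<open>k \<Gamma>(u)\<close>.  Inserting this
  into the first bound and dividing by \<open>w \<Gamma>(u)\<close> gives the second claim; at points with
  \<open>\<Gamma>(u)(x) = 0\<close> tensoriality makes the remaining term \<open>H\<^sub>w(u, u)(x)\<close> vanish.\<close>

section \<open>Smoothness of polynomial maps\<close>

text \<open>Polynomials in the coordinates, taken as a class closed under partial differentiation, so that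
  smoothness of all orders follows by one induction on the order.\<close>
inductive polynomial_map :: "nat \<Rightarrow> ((nat \<Rightarrow> real) \<Rightarrow> real) \<Rightarrow> bool" for r where
  const: "polynomial_map r (\<lambda>x. c)"
| coord: "i < r \<Longrightarrow> polynomial_map r (\<lambda>x. x i)"
| add: "polynomial_map r p \<Longrightarrow> polynomial_map r q \<Longrightarrow> polynomial_map r (\<lambda>x. p x + q x)"
| mult: "polynomial_map r p \<Longrightarrow> polynomial_map r q \<Longrightarrow> polynomial_map r (\<lambda>x. p x * q x)"

lemma polynomial_map_differentiable:
  assumes "polynomial_map r p"
  shows "(\<lambda>t. p (x(i := t))) field_differentiable at t"
  using assms
proof induction
  case (coord j)
  then show ?case by (cases "j = i") (auto intro: derivative_intros)
qed (auto intro: derivative_intros)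

lemma partial_deriv_coord: "partial_deriv i (\<lambda>x. x j) = (\<lambda>x. if i = j then 1 else 0)"
  by (auto simp: partial_deriv_def fun_eq_iff)

lemma partial_deriv_add:
  assumes "polynomial_map r p" "polynomial_map r q"
  shows "partial_deriv i (\<lambda>x. p x + q x) = (\<lambda>x. partial_deriv i p x + partial_deriv i q x)"
  using assms by (auto simp: partial_deriv_def fun_eq_iff polynomial_map_differentiable)

lemma partial_deriv_mult:
  assumes "polynomial_map r p" "polynomial_map r q"
  shows "partial_deriv i (\<lambda>x. p x * q x) =
    (\<lambda>x. p x * partial_deriv i q x + partial_deriv i p x * q x)"
  using assms by (auto simp: partial_deriv_def fun_eq_iff polynomial_map_differentiable)

lemma polynomial_map_partial_deriv:
  assumes "polynomial_map r p"
  shows "polynomial_map r (partial_deriv i p)"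
  using assms
proof induction
  case (const c)
  then show ?case by (simp add: partial_deriv_def[abs_def] polynomial_map.const)
next
  case (coord j)
  then show ?case by (simp add: partial_deriv_coord polynomial_map.const)
next
  case (add p q)
  then show ?case by (simp add: partial_deriv_add polynomial_map.add)
next
  case (mult p q)
  then show ?case
    by (simp add: partial_deriv_mult polynomial_map.add polynomial_map.mult)
qed

lemma polynomial_map_continuous:
  assumes "polynomial_map r p"
  shows "continuous_map (Euclidean_space r) euclideanreal p"
  using assms
proof induction
  case (coord j)
  then show ?case
    unfolding Euclidean_space_def
    by (intro continuous_map_from_subtopology continuous_map_product_projection) simp
qed (auto intro: continuous_intros)

lemma polynomial_map_Cinf:
  assumes "polynomial_map r p"
  shows "Cinf_on_Rn r p"
proof -
  have "Ck_on_Rn k r p" for k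
    using assms
    by (induction k arbitrary: p)
      (auto simp: polynomial_map_continuous polynomial_map_differentiable
        polynomial_map_partial_deriv)
  then show ?thesis by (simp add: Cinf_on_Rn_def)
qed

section \<open>The carre du champ as a derivation\<close>

context diffusion_operator
begin

lemma diff_mem: "g \<in> A \<Longrightarrow> h \<in> A \<Longrightarrow> (\<lambda>x. g x - h x) \<in> A"
  using add_mem[OF _ scale_mem[of h "-1"], of g] by simp

lemma L_diff: "g \<in> A \<Longrightarrow> h \<in> A \<Longrightarrow> L (\<lambda>x. g x - h x) x = L g x - L h x"
  using L_add[OF _ scale_mem[of h "-1"], of g] L_scale[of h "-1"] by simp

lemma L_zero: "L (\<lambda>y. 0) = (\<lambda>y. 0)"
  using L_scale[OF zero_mem, of 0] by simp

lemma L_mult: "L (\<lambda>y. g y * h y) x = g x * L h x + h x * L g x + 2 * Gam L g h x"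
  by (simp add: Gam_def field_simps)

lemma Gam_mem: "g \<in> A \<Longrightarrow> h \<in> A \<Longrightarrow> Gam L g h \<in> A"
  unfolding Gam_def by (intro scale_mem diff_mem mult_mem L_mem)

lemma Gam_sym: "Gam L g h = Gam L h g"
  by (auto simp: Gam_def fun_eq_iff mult.commute)

lemma Gam_add_left:
  assumes "g \<in> A" "h \<in> A" "k \<in> A"
  shows "Gam L (\<lambda>y. g y + h y) k x = Gam L g k x + Gam L h k x"
proof -
  have "L (\<lambda>y. (g y + h y) * k y) x = L (\<lambda>y. g y * k y) x + L (\<lambda>y. h y * k y) x"
    using assms by (simp add: distrib_right L_add mult_mem)
  then show ?thesis
    using assms by (simp add: Gam_def L_add algebra_simps)
qed

lemma Gam_scale_left:
  assumes "g \<in> A" "k \<in> A"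
  shows "Gam L (\<lambda>y. c * g y) k x = c * Gam L g k x"
proof -
  have "L (\<lambda>y. (c * g y) * k y) x = c * L (\<lambda>y. g y * k y) x"
    using L_scale[of "\<lambda>y. g y * k y" c] assms by (simp add: mult.assoc mult_mem)
  then show ?thesis
    using assms by (simp add: Gam_def L_scale algebra_simps)
qed

lemma Gam_diff_left:
  assumes "g \<in> A" "h \<in> A" "k \<in> A"
  shows "Gam L (\<lambda>y. g y - h y) k x = Gam L g k x - Gam L h k x"
  using Gam_add_left[of g "\<lambda>y. -1 * h y" k x] Gam_scale_left[of h k "-1" x] assms
    scale_mem[of h "-1"] by simp

text \<open>The chain rule for \<open>\<psi>(x) = x\<^sub>0 x\<^sub>1 x\<^sub>2\<close>.  The product of two factors would give only the definition of
  \<open>\<Gamma>\<close> back; three factors are the least degree that contains the Leibniz rule for \<open>\<Gamma>\<close>.\<close>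
lemma L_mult3:
  assumes "g \<in> A" "h \<in> A" "k \<in> A"
  shows "L (\<lambda>y. g y * h y * k y) x =
    g x * h x * L k x + g x * k x * L h x + h x * k x * L g x
    + 2 * (g x * Gam L h k x + h x * Gam L g k x + k x * Gam L g h x)"
proof -
  define fs where "fs = (\<lambda>i::nat. if i = 0 then g else if i = 1 then h else k)"
  define \<psi> :: "(nat \<Rightarrow> real) \<Rightarrow> real" where "\<psi> = (\<lambda>z. z 0 * z 1 * z 2)"
  have X: "polynomial_map 3 (\<lambda>z. z i)" if "i < 3" for i
    using that by (rule polynomial_map.coord)
  have poly: "polynomial_map 3 (\<lambda>z. z i * z j)" if "i < 3" "j < 3" for i j
    using that by (intro polynomial_map.mult X)
  have d1: "partial_deriv i \<psi> = (\<lambda>z. if i = 0 then z 1 * z 2 else if i = 1 then z 0 * z 2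
      else if i = 2 then z 0 * z 1 else 0)" for i
    unfolding \<psi>_def
    by (subst partial_deriv_mult[OF poly X], simp_all,
        subst partial_deriv_mult[OF X X], auto simp: partial_deriv_coord fun_eq_iff)
  have d2: "partial_deriv i (\<lambda>z. z j * z l) =
      (\<lambda>z. (if i = j then z l else 0) + (if i = l then z j else 0))" if "j < 3" "l < 3" for i j l
    using that by (subst partial_deriv_mult[OF X X]) (auto simp: partial_deriv_coord fun_eq_iff)
  have "L (\<lambda>y. \<psi> (tuple_map 3 fs y)) =
          (\<lambda>x. (\<Sum>i<3. partial_deriv i \<psi> (tuple_map 3 fs x) * L (fs i) x)
             + (\<Sum>i<3. \<Sum>j<3. partial_deriv j (partial_deriv i \<psi>) (tuple_map 3 fs x)
                                * Gam L (fs i) (fs j) x))"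
  proof (rule chain_rule)
    show "Cinf_on_Rn 3 \<psi>"
      unfolding \<psi>_def by (intro polynomial_map_Cinf polynomial_map.mult X) auto
  qed (use assms in \<open>auto simp: fs_def \<psi>_def\<close>)
  moreover have "(\<lambda>y. \<psi> (tuple_map 3 fs y)) = (\<lambda>y. g y * h y * k y)"
    by (simp add: \<psi>_def tuple_map_def fs_def)
  ultimately show ?thesis
    by (simp add: numeral_3_eq_3 d1 d2 tuple_map_def fs_def algebra_simps
        Gam_sym[of h g] Gam_sym[of k g] Gam_sym[of k h])
qed

lemma Gam_mult_left:
  assumes "g \<in> A" "h \<in> A" "k \<in> A"
  shows "Gam L (\<lambda>y. g y * h y) k x = g x * Gam L h k x + h x * Gam L g k x"
  using L_mult3[OF assms, of x]
  by (simp add: Gam_def[of L "\<lambda>y. g y * h y"] L_mult algebra_simps)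

lemma Gam_add_right: "\<lbrakk>g \<in> A; h \<in> A; k \<in> A\<rbrakk> \<Longrightarrow>
    Gam L k (\<lambda>y. g y + h y) x = Gam L k g x + Gam L k h x"
  and Gam_scale_right: "\<lbrakk>g \<in> A; k \<in> A\<rbrakk> \<Longrightarrow>
    Gam L k (\<lambda>y. c * g y) x = c * Gam L k g x"
  and Gam_diff_right: "\<lbrakk>g \<in> A; h \<in> A; k \<in> A\<rbrakk> \<Longrightarrow>
    Gam L k (\<lambda>y. g y - h y) x = Gam L k g x - Gam L k h x"
  and Gam_mult_right: "\<lbrakk>g \<in> A; h \<in> A; k \<in> A\<rbrakk> \<Longrightarrow>
    Gam L k (\<lambda>y. g y * h y) x = g x * Gam L k h x + h x * Gam L k g x"
  using Gam_add_left[of g h k x] Gam_scale_left[of g k c x]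
    Gam_diff_left[of g h k x] Gam_mult_left[of g h k x]
  by (simp_all add: Gam_sym[of k])

lemmas mem = add_mem scale_mem diff_mem mult_mem L_mem Gam_mem
text \<open>The degenerate case of the Cauchy--Schwarz inequality: for \<open>\<Gamma>(g)(x) = 0\<close> the polynomial
  \<open>\<Gamma>(t g + h)(x) \<ge> 0\<close> is affine in \<open>t\<close>, hence constant.\<close>
lemma Gam_eq_0_of_null:
  assumes "g \<in> A" "h \<in> A" "Gam L g g x = 0"
  shows "Gam L g h x = 0"
proof (rule ccontr)
  let ?b = "Gam L g h x" and ?c = "Gam L h h x"
  assume "?b \<noteq> 0"
  have nonneg: "0 \<le> 2 * t * ?b + ?c" for t
    using Gam_nonneg[of "\<lambda>y. t * g y + h y" x] assms
    by (simp add: Gam_add_left Gam_add_right Gam_scale_left Gam_scale_right mem Gam_sym[of h g])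
  (* At this t the affine function takes the value -1. *)
  from nonneg[of "- (?c + 1) / (2 * ?b)"] \<open>?b \<noteq> 0\<close> show False
    by (simp add: field_simps)
qed

section \<open>Perturbations of second order at a point\<close>

text \<open>A factor \<open>g - g(x)\<close> vanishes at \<open>x\<close>, so after one differentiation only the term in which it is
  itself differentiated survives.  The factor is written out because constants need not lie
  in \<open>A\<close>.\<close>
lemma Gam_centred_factor:
  assumes "g \<in> A" "k \<in> A" "m \<in> A"
  shows "Gam L (\<lambda>y. g y * k y - g x * k y) m x = k x * Gam L g m x"
    and "Gam L m (\<lambda>y. g y * k y - g x * k y) x = k x * Gam L g m x"
proof -
  show "Gam L (\<lambda>y. g y * k y - g x * k y) m x = k x * Gam L g m x"
    using assms by (simp add: Gam_diff_left Gam_mult_left Gam_scale_left[of k] mem)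
  then show "Gam L m (\<lambda>y. g y * k y - g x * k y) x = k x * Gam L g m x"
    by (simp add: Gam_sym[of m])
qed

lemma L_centred_factor:
  assumes "g \<in> A" "k \<in> A"
  shows "L (\<lambda>y. g y * k y - g x * k y) x = k x * L g x + 2 * Gam L g k x"
proof -
  have "L (\<lambda>y. g y * k y - g x * k y) x = L (\<lambda>y. g y * k y) x - L (\<lambda>y. g x * k y) x"
    using assms by (intro L_diff mem)
  then show ?thesis
    using assms by (simp add: L_scale[of k] L_mult)
qed

text \<open>This is \<open>(g - g(x)) (h - h(x))\<close> without its constant term \<open>g(x) h(x)\<close>; dropping the constant keeps the
  function in \<open>A\<close> and does not change any derivative of it.\<close>
definition centred_product :: "'a \<Rightarrow> ('a \<Rightarrow> real) \<Rightarrow> ('a \<Rightarrow> real) \<Rightarrow> 'a \<Rightarrow> real" where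
  "centred_product x g h = (\<lambda>y. (g y * h y - g x * h y) - h x * g y)"

lemma centred_product_mem: "g \<in> A \<Longrightarrow> h \<in> A \<Longrightarrow> centred_product x g h \<in> A"
  unfolding centred_product_def by (intro mem)

lemma Gam_centred_product:
  assumes "g \<in> A" "h \<in> A" "k \<in> A"
  shows "Gam L (centred_product x g h) k =
    (\<lambda>y. (g y * Gam L h k y - g x * Gam L h k y) + (h y * Gam L g k y - h x * Gam L g k y))"
  using assms
  by (simp add: centred_product_def fun_eq_iff Gam_diff_left Gam_mult_left
      Gam_scale_left[of h] Gam_scale_left[of g] mem)

lemma L_centred_product:
  assumes "g \<in> A" "h \<in> A"
  shows "L (centred_product x g h) =
    (\<lambda>y. (g y * L h y - g x * L h y) + (h y * L g y - h x * L g y) + 2 * Gam L g h y)"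
  using assms
  by (simp add: centred_product_def fun_eq_iff L_diff L_mult
      L_scale[of h] L_scale[of g] mem)

lemma Gam2_centred_product_mixed:
  assumes [simp]: "v \<in> A" "g \<in> A" "h \<in> A"
  shows "Gam2 L v (centred_product x g h) x = 2 * Hess L v g h x"
proof -
  have 1: "L (Gam L v (centred_product x g h)) x =
    Gam L h v x * L g x + 2 * Gam L g (Gam L h v) x + Gam L g v x * L h x + 2 * Gam L h (Gam L g v) x"
    by (simp add: Gam_sym[of v "centred_product x g h"] Gam_centred_product
       L_add[THEN fun_cong] L_centred_factor mem)
  have 2: "Gam L v (L (centred_product x g h)) x =
    L h x * Gam L g v x + L g x * Gam L h v x + 2 * Gam L v (Gam L g h) x"
    by (simp add: L_centred_product Gam_add_right Gam_centred_factor
        Gam_scale_right[of "Gam L g h"] mem)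
  have 3: "Gam L (centred_product x g h) (L v) x = 0"
    by (simp add: Gam_centred_product mem)
  show ?thesis
    unfolding Gam2_def 1 2 3 by (simp add: Hess_def Gam_sym[of v] field_simps)
qed

text \<open>Apply the mixed formula with \<open>v\<close> the centred product \<open>p\<close> itself: the term \<open>\<Gamma>(p, \<Gamma>(g, h))\<close>
  of its Hessian vanishes at \<open>x\<close>, and in the two others exactly one centred factor is left to
  differentiate.\<close>
lemma Gam2_centred_product:
  assumes [simp]: "g \<in> A" "h \<in> A"
  shows "Gam2 L (centred_product x g h) (centred_product x g h) x =
    2 * (Gam L g g x * Gam L h h x + (Gam L g h x)\<^sup>2)"
proof -
  define p where "p = centred_product x g h"
  have [simp]: "p \<in> A" by (simp add: p_def centred_product_mem)
  have 1: "Gam L g (Gam L p h) x = Gam L h h x * Gam L g g x + Gam L g h x * Gam L g h x"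
    by (simp add: p_def Gam_centred_product Gam_add_right Gam_centred_factor mem Gam_sym[of h g])
  have 2: "Gam L h (Gam L p g) x = Gam L g h x * Gam L g h x + Gam L g g x * Gam L h h x"
    by (simp add: p_def Gam_centred_product Gam_add_right Gam_centred_factor mem Gam_sym[of h g])
  have 3: "Gam L p (Gam L g h) x = 0"
    by (simp add: p_def Gam_centred_product mem)
  have "Gam2 L p p x = 2 * Hess L p g h x"
    unfolding p_def by (simp add: Gam2_centred_product_mixed centred_product_mem)
  then show ?thesis
    unfolding Hess_def 1 2 3 p_def[symmetric]
    by (simp add: power2_eq_square field_simps)
qed

lemma Gam2_perturb:
  assumes [simp]: "v \<in> A" "p \<in> A"
  shows "Gam2 L (\<lambda>y. v y + s * p y) (\<lambda>y. v y + s * p y) x =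
    Gam2 L v v x + 2 * s * Gam2 L v p x + s\<^sup>2 * Gam2 L p p x"
proof -
  have 1: "Gam L (\<lambda>y. v y + s * p y) (\<lambda>y. v y + s * p y) =
      (\<lambda>y. Gam L v v y + (2 * s) * Gam L v p y + s\<^sup>2 * Gam L p p y)"
    by (simp add: fun_eq_iff Gam_add_left Gam_add_right Gam_scale_left Gam_scale_right mem
       Gam_sym[of p v] power2_eq_square algebra_simps)
  have 2: "L (\<lambda>y. v y + s * p y) = (\<lambda>y. L v y + s * L p y)"
    by (simp add: L_add L_scale mem)
  show ?thesis
    unfolding Gam2_def 1 2
    by (simp add: L_add L_scale Gam_add_left Gam_add_right Gam_scale_left Gam_scale_right mem)
       (simp add: power2_eq_square field_simps)
qed


text \<open>The device behind all estimates on the Ricci tensor: a change of \<open>v\<close> that is invisible to \<open>\<Gamma>\<close>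
  at \<open>x\<close> and affects \<open>L\<close> and \<open>\<Gamma>\<^sub>2\<close> there through first-order data and one Hessian only.\<close>
lemma quadratic_perturbation:
  fixes s :: real and x :: 'a
  assumes [simp]: "v \<in> A" "g \<in> A" "h \<in> A"
  defines "v' \<equiv> \<lambda>y. v y + s * centred_product x g h y"
  shows "v' \<in> A"
    and "k \<in> A \<Longrightarrow> Gam L v' k x = Gam L v k x"
    and "L v' x = L v x + 2 * s * Gam L g h x"
    and "Gam2 L v' v' x = Gam2 L v v x + 4 * s * Hess L v g h x
           + 2 * s\<^sup>2 * (Gam L g g x * Gam L h h x + (Gam L g h x)\<^sup>2)"
proof -
  define p where "p = centred_product x g h"
  have [simp]: "p \<in> A" by (simp add: p_def centred_product_mem)
  have v': "v' = (\<lambda>y. v y + s * p y)" by (simp add: v'_def p_def)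
  show "v' \<in> A" unfolding v' by (simp add: mem)
  show "Gam L v' k x = Gam L v k x" if "k \<in> A"
    using that by (simp add: v' Gam_add_left Gam_scale_left[of p] mem) (simp add: p_def Gam_centred_product)
  show "L v' x = L v x + 2 * s * Gam L g h x"
    by (simp add: v' L_add L_scale mem) (simp add: p_def L_centred_product)
  show "Gam2 L v' v' x = Gam2 L v v x + 4 * s * Hess L v g h x
           + 2 * s\<^sup>2 * (Gam L g g x * Gam L h h x + (Gam L g h x)\<^sup>2)"
    unfolding v' by (simp add: Gam2_perturb) (simp add: p_def Gam2_centred_product_mixed Gam2_centred_product)
qed

section \<open>Tensoriality of the Hessian\<close>

lemma Hess_sym: "Hess L f g h = Hess L f h g"
  by (simp add: Hess_def fun_eq_iff Gam_sym[of g h])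

lemma Hess_diff_left:
  assumes [simp]: "f \<in> A" "g \<in> A" "h \<in> A" "k \<in> A"
  shows "Hess L k (\<lambda>y. g y - f y) h x = Hess L k g h x - Hess L k f h x"
proof -
  have e: "Gam L (\<lambda>y. g y - f y) h = (\<lambda>y. Gam L g h y - Gam L f h y)"
    "Gam L k (\<lambda>y. g y - f y) = (\<lambda>y. Gam L k g y - Gam L k f y)"
    by (simp_all add: fun_eq_iff Gam_diff_left Gam_diff_right)
  show ?thesis
    unfolding Hess_def e by (simp add: Gam_diff_left Gam_diff_right mem) (simp add: field_simps)
qed

lemma Ricci_le:
  assumes "u \<in> A" "v \<in> A" "Gam L (\<lambda>y. v y - u y) (\<lambda>y. v y - u y) x = 0"
  shows "Ricci A L N u x \<le> ereal (Gam2 L v v x - 1 / N * (L v x)\<^sup>2)"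
  unfolding Ricci_def using assms by (intro INF_lower) auto

lemma Gam_transfer_null:
  assumes "u \<in> A" "v \<in> A" "k \<in> A" "Gam L (\<lambda>y. v y - u y) (\<lambda>y. v y - u y) x = 0"
  shows "Gam L v k x = Gam L u k x"
  using Gam_eq_0_of_null[of "\<lambda>y. v y - u y" k x] assms by (simp add: mem Gam_diff_left)

text \<open>Every \<open>v + s (g - g(x)) (w - w(x))\<close> competes in the infimum.  Since \<open>\<Gamma>(g, \<cdot>)(x) = 0\<close>, the term
  quadratic in \<open>s\<close> and the change of \<open>Lv\<close> disappear, so the value is affine in \<open>s\<close> with slope
  \<open>4 H\<^sub>v(g, w)(x)\<close>; a nonzero slope would drive the infimum to \<open>-\<infinity>\<close>.\<close>
lemma Hess_null_of_Ricci_finite: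
  assumes [simp]: "u \<in> A" "v \<in> A" "g \<in> A" "w \<in> A"
    and v: "Gam L (\<lambda>y. v y - u y) (\<lambda>y. v y - u y) x = 0"
    and g: "Gam L g g x = 0"
    and fin: "Ricci A L N u x \<noteq> - \<infinity>"
  shows "Hess L v g w x = 0"
proof (rule ccontr)
  assume nz: "Hess L v g w x \<noteq> 0"
  have gw: "Gam L g w x = 0" using g by (simp add: Gam_eq_0_of_null)
  define c where "c = Gam2 L v v x - 1 / N * (L v x)\<^sup>2"
  have le: "Ricci A L N u x \<le> ereal (c + 4 * s * Hess L v g w x)" for s
  proof -
    define v' where "v' = (\<lambda>y. v y + s * centred_product x g w y)"
    note pert = quadratic_perturbation[where v = v and g = g and h = w and s = s and x = x,
        folded v'_def, simplified]
    have "Gam L (\<lambda>y. v' y - u y) k x = 0" if [simp]: "k \<in> A" for k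
      using pert(2)[of k] pert(1) Gam_transfer_null[OF _ _ _ v, of k]
      by (simp add: Gam_diff_left)
    then have "Ricci A L N u x \<le> ereal (Gam2 L v' v' x - 1 / N * (L v' x)\<^sup>2)"
      using pert(1) by (intro Ricci_le) (auto simp: mem)
    then show ?thesis
      using pert(3,4) by (simp add: gw g c_def algebra_simps)
  qed
  have "Ricci A L N u x \<le> ereal B" for B
    using le[of "(B - c) / (4 * Hess L v g w x)"] nz by (simp add: field_simps)
  then have "Ricci A L N u x = - \<infinity>"
    by (rule ereal_bot)
  with fin show False by simp
qed

text \<open>With \<open>g = v - u\<close> the difference of both sides is \<open>H\<^sub>w(g, v) + H\<^sub>w(g, u)\<close>.  Because \<open>\<Gamma>(g, \<cdot>)\<close> vanishes
  at \<open>x\<close>, exchanging the base function \<open>w\<close> with the other argument only changes the sign, and then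
  the previous lemma applies, once with competitor \<open>v\<close> and once with competitor \<open>u\<close>.\<close>
lemma Hess_cong_of_Ricci_finite:
  assumes [simp]: "u \<in> A" "v \<in> A" "w \<in> A"
    and v: "Gam L (\<lambda>y. v y - u y) (\<lambda>y. v y - u y) x = 0"
    and fin: "Ricci A L N u x \<noteq> - \<infinity>"
  shows "Hess L w v v x = Hess L w u u x"
proof -
  define g where "g = (\<lambda>y. v y - u y)"
  have [simp]: "g \<in> A" by (simp add: g_def mem)
  have g: "Gam L g g x = 0" using v by (simp add: g_def)
  have swap: "Hess L w g k x = - Hess L k g w x" if [simp]: "k \<in> A" for k
    using Gam_sym[of k g] Gam_sym[of w g]
    by (simp add: Hess_def Gam_eq_0_of_null g mem Gam_sym[of k w] field_simps)
  have "Hess L w g v x = 0" "Hess L w g u x = 0"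
    using Hess_null_of_Ricci_finite[of u v g w x N] Hess_null_of_Ricci_finite[of u u g w x N]
    by (simp_all add: swap v g fin Gam_def[of L "\<lambda>y. 0"] L_zero)
  then show ?thesis
    by (simp add: g_def Hess_diff_left Hess_sym[of w u v])
qed


section \<open>The conformal change\<close>

lemma Hess_self: "f \<in> A \<Longrightarrow> Hess L v f v x = 1/2 * Gam L f (Gam L v v) x"
  by (simp add: Hess_def Gam_sym[of f v])

lemma Gam_square_left:
  assumes "f \<in> A" "u \<in> A"
  shows "Gam L (\<lambda>y. (f y)\<^sup>2) u x = 2 * f x * Gam L f u x"
  using Gam_mult_left[OF assms(1,1,2)] by (simp add: power2_eq_square)

lemma square_mem: "f \<in> A \<Longrightarrow> (\<lambda>y. (f y)\<^sup>2) \<in> A"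
  by (simp add: power2_eq_square mult_mem)

lemma Hess_square:
  assumes [simp]: "f \<in> A" "u \<in> A"
  shows "Hess L (\<lambda>y. (f y)\<^sup>2) u u x = 2 * (Gam L f u x)\<^sup>2 + 2 * f x * Hess L f u u x"
proof -
  have e: "Gam L (\<lambda>y. (f y)\<^sup>2) u = (\<lambda>y. 2 * (f y * Gam L f u y))"
    by (simp add: fun_eq_iff Gam_square_left)
  have "Gam L u (Gam L (\<lambda>y. (f y)\<^sup>2) u) x = 2 * (f x * Gam L u (Gam L f u) x + Gam L f u x * Gam L u f x)"
    unfolding e by (simp add: Gam_scale_right[of "\<lambda>y. f y * Gam L f u y"] Gam_mult_right mem)
  then show ?thesis
    by (simp add: Hess_def Gam_square_left mem) (simp add: Gam_sym[of u f] power2_eq_square field_simps)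
qed

lemma L_square: "L (\<lambda>y. (f y)\<^sup>2) x = 2 * f x * L f x + 2 * Gam L f f x"
  using L_mult[of f f x] by (simp add: power2_eq_square)

text \<open>The drift \<open>u \<mapsto> \<Gamma>(f\<^sup>2, u)\<close> is a derivation and so contributes nothing to the carre du champ.\<close>
lemma Gam_conformal:
  assumes [simp]: "f \<in> A" "u \<in> A" "v \<in> A"
  shows "Gam (conformal L f N) u v = (\<lambda>x. (f x)\<^sup>2 * Gam L u v x)"
  by (simp add: Gam_def[of "conformal L f N"] conformal_def fun_eq_iff Gam_mult_right square_mem L_mult
      field_simps)

lemma conformal_mem: "f \<in> A \<Longrightarrow> u \<in> A \<Longrightarrow> conformal L f N u \<in> A"
  unfolding conformal_def by (intro mem square_mem)

lemma Gam2_conformal: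
  fixes f N
  assumes f[simp]: "f \<in> A" and [simp]: "u \<in> A"
  defines "w \<equiv> \<lambda>y. (f y)\<^sup>2" and "a \<equiv> (N - 2) / 2"
  shows "Gam2 (conformal L f N) u u x =
    (w x)\<^sup>2 * Gam2 L u u x + 1/2 * w x * L w x * Gam L u u x + w x * Gam L w (Gam L u u) x
    - a / 2 * Gam L w w x * Gam L u u x - w x * L u x * Gam L w u x + a * w x * Hess L w u u x"
proof -
  have w[simp]: "w \<in> A" using f by (simp add: w_def square_mem)
  have c: "conformal L f N u = (\<lambda>y. w y * L u y - a * Gam L w u y)" if "u \<in> A" for u
    by (simp add: conformal_def w_def a_def fun_eq_iff)
  have G: "Gam (conformal L f N) u v = (\<lambda>y. w y * Gam L u v y)" if "u \<in> A" "v \<in> A" for u v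
    using that by (simp add: Gam_conformal w_def)
  have 1: "conformal L f N (\<lambda>y. w y * Gam L u u y) x =
      w x * (w x * L (Gam L u u) x + Gam L u u x * L w x + 2 * Gam L w (Gam L u u) x)
      - a * (w x * Gam L w (Gam L u u) x + Gam L u u x * Gam L w w x)"
    by (simp add: c mem L_mult Gam_mult_right)
  have 2: "Gam L u (conformal L f N u) x =
      w x * Gam L u (L u) x + L u x * Gam L u w x - a * Gam L u (Gam L w u) x"
    by (simp add: c Gam_diff_right Gam_mult_right Gam_scale_right[of "Gam L w u"] mem)
  show ?thesis
    unfolding Gam2_def[of "conformal L f N"]
    by (simp add: G conformal_mem 1 2)
       (simp add: Gam2_def Hess_def Gam_sym[of u w] power2_eq_square field_simps)
qed

text \<open>The coefficient \<open>s = 1 / (2 w(x))\<close> is the one for which \<open>w\<^sup>2 \<cdot> 4 s H\<^sub>v(v, w) = 2 w H\<^sub>v(v, w)\<close>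
  equals the term \<open>w \<Gamma>(w, \<Gamma>(v))\<close> of the conformal \<open>\<Gamma>\<^sub>2\<close>.  All remaining terms then match as well, so
  the two functionals agree exactly and nothing is lost in the estimate.\<close>
lemma optimal_perturbation:
  fixes f :: "'a \<Rightarrow> real" and N :: real and x :: 'a
  assumes f[simp]: "f \<in> A" and [simp]: "v \<in> A" and N: "N \<noteq> 0" and fx: "f x \<noteq> 0"
  defines "w \<equiv> \<lambda>y. (f y)\<^sup>2"
  defines "v' \<equiv> \<lambda>y. v y + 1 / (2 * w x) * centred_product x v w y"
  shows "Gam2 (conformal L f N) v v x - 1 / N * (conformal L f N v x)\<^sup>2 =
    (w x)\<^sup>2 * (Gam2 L v' v' x - 1 / N * (L v' x)\<^sup>2)
    + ((1/2 * w x * L w x - N/4 * Gam L w w x) * Gam L v v x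
       - (N - 2)/4 * (Gam L w v x)\<^sup>2 + (N - 2)/2 * w x * Hess L w v v x)"
proof -
  have w[simp]: "w \<in> A" using f by (simp add: w_def square_mem)
  have wx: "w x \<noteq> 0" using fx by (simp add: w_def)
  have c: "conformal L f N v x = w x * L v x - (N - 2) / 2 * Gam L w v x"
    by (simp add: conformal_def w_def)
  note pert = quadratic_perturbation[where v = v and g = v and h = w and s = "1 / (2 * w x)" and x = x,
      folded v'_def, simplified]
  have L': "w x * L v' x = w x * L v x + Gam L w v x"
    using wx pert(3) by (simp add: Gam_sym[of v w] field_simps)
  have H: "Hess L v v w x = 1/2 * Gam L w (Gam L v v) x"
    using Hess_self[of w v x] by (simp add: Hess_sym[of v v])
  have G': "(w x)\<^sup>2 * Gam2 L v' v' x = (w x)\<^sup>2 * Gam2 L v v x + w x * Gam L w (Gam L v v) x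
      + 1/2 * (Gam L v v x * Gam L w w x + (Gam L w v x)\<^sup>2)"
    using wx by (simp add: pert(4) H Gam_sym[of v w] power2_eq_square) (simp add: field_simps)
  have rhs: "(w x)\<^sup>2 * (Gam2 L v' v' x - 1 / N * (L v' x)\<^sup>2) =
      ((w x)\<^sup>2 * Gam2 L v v x + w x * Gam L w (Gam L v v) x
      + 1/2 * (Gam L v v x * Gam L w w x + (Gam L w v x)\<^sup>2))
      - 1 / N * (w x * L v x + Gam L w v x)\<^sup>2"
    unfolding G'[symmetric] L'[symmetric] by (simp add: power_mult_distrib right_diff_distrib)
  have lhs: "Gam2 (conformal L f N) v v x =
    (w x)\<^sup>2 * Gam2 L v v x + 1/2 * w x * L w x * Gam L v v x + w x * Gam L w (Gam L v v) x
    - (N - 2) / 4 * Gam L w w x * Gam L v v x - w x * L v x * Gam L w v x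
    + (N - 2) / 2 * w x * Hess L w v v x"
    by (simp add: Gam2_conformal w_def)
  show ?thesis
    unfolding c lhs rhs using N by (simp add: power2_eq_square field_simps)
qed

text \<open>Each competitor \<open>v\<close> for the conformal operator is estimated by the competitor \<open>v'\<close> for \<open>L\<close> from
  the exact identity above; the first-order data and, by tensoriality, the Hessian of \<open>v\<close> may then be
  replaced by those of \<open>u\<close>.\<close>
lemma Ricci_conformal_lower_bound:
  fixes f :: "'a \<Rightarrow> real" and N :: real and x :: 'a
  assumes f[simp]: "f \<in> A" and u[simp]: "u \<in> A" and N: "N \<noteq> 0"
  defines "w \<equiv> \<lambda>y. (f y)\<^sup>2"
  defines "E \<equiv> (1/2 * w x * L w x - N/4 * Gam L w w x) * Gam L u u x
       - (N - 2)/4 * (Gam L w u x)\<^sup>2 + (N - 2)/2 * w x * Hess L w u u x"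
  shows "ereal ((w x)\<^sup>2) * Ricci A L N u x + ereal E \<le> Ricci A (conformal L f N) N u x"
proof -
  have w[simp]: "w \<in> A" using f by (simp add: w_def square_mem)
  have "ereal ((w x)\<^sup>2) * Ricci A L N u x + ereal E
      \<le> ereal (Gam2 (conformal L f N) v v x - 1 / N * (conformal L f N v x)\<^sup>2)"
    if v[simp]: "v \<in> A" and null: "(f x)\<^sup>2 * Gam L (\<lambda>y. v y - u y) (\<lambda>y. v y - u y) x = 0" for v
  proof (cases "f x = 0")
    case True
    then have null: "w x = 0" "\<And>k. k \<in> A \<Longrightarrow> Gam L w k x = 0"
      by (simp_all add: w_def Gam_square_left)
    have lhs: "ereal ((w x)\<^sup>2) = 0" "ereal E = 0"
      using null by (simp_all add: E_def)
    have "conformal L f N v x = 0"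
      using null(2)[of v] True by (simp add: conformal_def w_def)
    moreover have "Gam2 (conformal L f N) v v x = 0"
      using null True by (simp add: Gam2_conformal mem flip: w_def)
    ultimately have rhs: "Gam2 (conformal L f N) v v x - 1 / N * (conformal L f N v x)\<^sup>2 = 0"
      by simp
    show ?thesis
      unfolding lhs rhs by simp
  next
    case False
    then have wx: "0 < (w x)\<^sup>2" by (simp add: w_def)
    from False null have null: "Gam L (\<lambda>y. v y - u y) (\<lambda>y. v y - u y) x = 0" by simp
    define v' where "v' = (\<lambda>y. v y + 1 / (2 * w x) * centred_product x v w y)"
    note pert = quadratic_perturbation[where v = v and g = v and h = w and s = "1 / (2 * w x)" and x = x,
        folded v'_def, simplified]
    show ?thesis
    proof (cases "Ricci A L N u x = - \<infinity>")
      case True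
      then show ?thesis using wx by simp
    next
      case fin: False
      have "Gam L (\<lambda>y. v' y - u y) k x = 0" if [simp]: "k \<in> A" for k
        using pert(2)[of k] pert(1) Gam_transfer_null[OF _ _ _ null, of k]
        by (simp add: Gam_diff_left)
      then have "Ricci A L N u x \<le> ereal (Gam2 L v' v' x - 1 / N * (L v' x)\<^sup>2)"
        using pert(1) by (intro Ricci_le) (auto simp: mem)
      then have "ereal ((w x)\<^sup>2) * Ricci A L N u x + ereal E
          \<le> ereal ((w x)\<^sup>2) * ereal (Gam2 L v' v' x - 1 / N * (L v' x)\<^sup>2) + ereal E"
        by (intro add_right_mono ereal_mult_left_mono) auto
      moreover have "Gam L v v x = Gam L u u x"
        using Gam_transfer_null[OF u v v null] Gam_transfer_null[OF u v u null]
        by (simp add: Gam_sym[of u v])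
      moreover have "Gam L w v x = Gam L w u x"
        using Gam_transfer_null[OF u v w null] by (metis Gam_sym)
      moreover have "Hess L w v v x = Hess L w u u x"
        using Hess_cong_of_Ricci_finite[OF u v w null fin] .
      moreover have "Gam2 (conformal L f N) v v x - 1 / N * (conformal L f N v x)\<^sup>2 =
        (w x)\<^sup>2 * (Gam2 L v' v' x - 1 / N * (L v' x)\<^sup>2)
        + ((1/2 * w x * L w x - N/4 * Gam L w w x) * Gam L v v x
           - (N - 2)/4 * (Gam L w v x)\<^sup>2 + (N - 2)/2 * w x * Hess L w v v x)"
        unfolding v'_def w_def by (rule optimal_perturbation[OF f v N False])
      ultimately show ?thesis
        by (simp only: E_def times_ereal.simps plus_ereal.simps)
    qed
  qed
  then show ?thesis
    unfolding Ricci_def[of A "conformal L f N"]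
    by (intro INF_greatest) (auto simp: Gam_conformal mem)
qed

section \<open>The Bakry--Emery condition\<close>

lemma Ricci_ge_of_BE:
  assumes "BE A L (\<lambda>x. ereal (k x)) N" "u \<in> A"
  shows "ereal (k x * Gam L u u x) \<le> Ricci A L N u x"
  unfolding Ricci_def
proof (intro INF_greatest, clarify)
  fix v assume v: "v \<in> A" "Gam L (\<lambda>y. v y - u y) (\<lambda>y. v y - u y) x = 0"
  have "Gam L v v x = Gam L u u x"
    using Gam_transfer_null[OF assms(2) v(1) v(1) v(2)] Gam_transfer_null[OF assms(2) v(1) assms(2) v(2)]
      Gam_sym[of v u] by simp
  moreover have "k x * Gam L v v x + 1 / N * (L v x)\<^sup>2 \<le> Gam2 L v v x"
    using assms(1) v(1) by (simp add: BE_def)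
  ultimately show "ereal (k x * Gam L u u x) \<le> ereal (Gam2 L v v x - 1 / N * (L v x)\<^sup>2)"
    by simp
qed

text \<open>The bound on the conformal Ricci tensor, tested with \<open>u\<close> itself.  As \<open>\<Gamma>(w) = 4 w \<Gamma>(f)\<close> and
  \<open>\<Gamma>(w, u)\<^sup>2 = 4 w \<Gamma>(f, u)\<^sup>2\<close>, every term contains the factor \<open>w = f\<^sup>2\<close>, which is the factor by
  which the conformal \<open>\<Gamma>(u)\<close> differs from that of \<open>L\<close>.\<close>
lemma Gam2_conformal_lower_bound_of_BE:
  assumes be: "BE A L (\<lambda>x. ereal (k x)) N" and f[simp]: "f \<in> A" and u[simp]: "u \<in> A" and N: "N \<noteq> 0"
  shows "(f x)\<^sup>2 * (((f x)\<^sup>2 * k x + 1/2 * L (\<lambda>y. (f y)\<^sup>2) x - N * Gam L f f x) * Gam L u u x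
      + (- (N - 2) * (Gam L f u x)\<^sup>2 + (N - 2)/2 * Hess L (\<lambda>y. (f y)\<^sup>2) u u x))
      + 1 / N * (conformal L f N u x)\<^sup>2 \<le> Gam2 (conformal L f N) u u x"
proof -
  define w where "w = (\<lambda>y. (f y)\<^sup>2)"
  have w[simp]: "w \<in> A" using f by (simp add: w_def square_mem)
  define E where "E = (1/2 * w x * L w x - N/4 * Gam L w w x) * Gam L u u x
       - (N - 2)/4 * (Gam L w u x)\<^sup>2 + (N - 2)/2 * w x * Hess L w u u x"
  have "ereal ((w x)\<^sup>2 * (k x * Gam L u u x) + E)
      \<le> ereal ((w x)\<^sup>2) * Ricci A L N u x + ereal E"
    using add_right_mono[OF ereal_mult_left_mono[OF Ricci_ge_of_BE[OF be u, of x], of "ereal ((w x)\<^sup>2)"],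
        of "ereal E"] by simp
  also have "\<dots> \<le> Ricci A (conformal L f N) N u x"
    using Ricci_conformal_lower_bound[OF f u N] by (simp add: E_def w_def)
  also have "\<dots> \<le> ereal (Gam2 (conformal L f N) u u x - 1 / N * (conformal L f N u x)\<^sup>2)"
    unfolding Ricci_def
    by (intro INF_lower) (simp add: Gam_conformal mem Gam_def[of L "\<lambda>y. 0"] L_zero zero_mem)
  finally have le: "(w x)\<^sup>2 * (k x * Gam L u u x) + E
      \<le> Gam2 (conformal L f N) u u x - 1 / N * (conformal L f N u x)\<^sup>2" by simp
  have Gu: "(Gam L w u x)\<^sup>2 = 4 * w x * (Gam L f u x)\<^sup>2"
    by (simp add: w_def Gam_square_left power_mult_distrib)
  have Gw: "Gam L w w x = 4 * w x * Gam L f f x"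
  proof -
    have "Gam L w w x = 2 * f x * Gam L w f x"
      using Gam_square_left[OF f w, folded w_def] by (simp add: Gam_sym[of f w])
    also have "Gam L w f x = 2 * f x * Gam L f f x"
      by (simp add: w_def Gam_square_left)
    finally show ?thesis by (simp add: w_def power2_eq_square)
  qed
  have eq: "(w x)\<^sup>2 * (k x * Gam L u u x) + E = w x * ((w x * k x + 1/2 * L w x - N * Gam L f f x) * Gam L u u x
      + (- (N - 2) * (Gam L f u x)\<^sup>2 + (N - 2)/2 * Hess L w u u x))"
    unfolding E_def Gu Gw by (simp add: power2_eq_square field_simps)
  show ?thesis
    using le unfolding eq by (simp only: w_def le_diff_eq)
qed

text \<open>As \<open>\<Gamma>(u, \<cdot>)\<close> vanishes at \<open>x\<close>, the left-hand side reduces there to \<open>- \<Gamma>(w, \<Gamma>(u)) / 2 = - H\<^sub>u(u, w)\<close>,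
  and the Bakry--Emery condition keeps the Ricci tensor of \<open>u\<close> above \<open>-\<infinity>\<close>.\<close>
lemma Hess_eq_0_of_BE:
  assumes be: "BE A L (\<lambda>x. ereal (k x)) N" and [simp]: "u \<in> A" "w \<in> A"
    and u: "Gam L u u x = 0"
  shows "Hess L w u u x = 0"
proof -
  have "Ricci A L N u x \<noteq> - \<infinity>"
    using Ricci_ge_of_BE[OF be \<open>u \<in> A\<close>, of x] by auto
  then have "Hess L u u w x = 0"
    using u by (intro Hess_null_of_Ricci_finite[of u u u w x N])
      (simp_all add: Gam_def[of L "\<lambda>y. 0"] L_zero)
  then have "Gam L w (Gam L u u) x = 0"
    using Hess_self[of w u x] by (simp add: Hess_sym[of u u])
  moreover have "Gam L u (Gam L w u) x = 0"
    using u by (rule Gam_eq_0_of_null[rotated -1]) (simp_all add: mem)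
  ultimately show ?thesis
    by (simp add: Hess_def)
qed

text \<open>The infimum \<open>I\<close> may be \<open>-\<infinity>\<close>, or \<open>+\<infinity>\<close> when \<open>\<Gamma>(u)(x) = 0\<close> for all \<open>u\<close>.  Where \<open>\<Gamma>(u)(x) = 0\<close> the
  product with \<open>I\<close> is zero by convention, and it has to be shown that the rest of the bound
  vanishes too; elsewhere \<open>u\<close> takes part in the infimum.\<close>
lemma BE_conformal:
  assumes be: "BE A L (\<lambda>x. ereal (k x)) N" and f[simp]: "f \<in> A" and N: "N \<noteq> 0"
  shows "BE A (conformal L f N)
    (\<lambda>x. ereal ((f x)\<^sup>2 * k x + 1/2 * L (\<lambda>y. (f y)\<^sup>2) x - N * Gam L f f x)
       + (INF u \<in> {u \<in> A. Gam L u u x > 0}.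
            ereal (1 / Gam L u u x * (- (N - 2) * (Gam L f u x)\<^sup>2
                     + (N - 2)/2 * Hess L (\<lambda>y. (f y)\<^sup>2) u u x)))) N"
  unfolding BE_def
proof (intro ballI allI)
  fix u x assume u[simp]: "u \<in> A"
  define w where "w = (\<lambda>y. (f y)\<^sup>2)"
  have w[simp]: "w \<in> A" using f by (simp add: w_def square_mem)
  define K where "K = (f x)\<^sup>2 * k x + 1/2 * L w x - N * Gam L f f x"
  define Q where "Q = (\<lambda>u. - (N - 2) * (Gam L f u x)\<^sup>2 + (N - 2)/2 * Hess L w u u x)"
  define I where "I = (INF u \<in> {u \<in> A. Gam L u u x > 0}. ereal (1 / Gam L u u x * Q u))"
  have bound: "(f x)\<^sup>2 * (K * Gam L u u x + Q u) + 1 / N * (conformal L f N u x)\<^sup>2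
      \<le> Gam2 (conformal L f N) u u x"
    using Gam2_conformal_lower_bound_of_BE[OF be f u N, of x] by (simp add: K_def Q_def w_def)
  have "(ereal K + I) * ereal ((f x)\<^sup>2 * Gam L u u x) \<le> ereal ((f x)\<^sup>2 * (K * Gam L u u x + Q u))"
  proof (cases "Gam L u u x = 0")
    case True
    then have "Q u = 0"
      using Hess_eq_0_of_BE[OF be u w True] Gam_eq_0_of_null[OF u f True] Gam_sym[of f u]
      by (simp add: Q_def)
    then have null: "ereal ((f x)\<^sup>2 * Gam L u u x) = 0"
        "ereal ((f x)\<^sup>2 * (K * Gam L u u x + Q u)) = 0"
      using True by simp_all
    show ?thesis unfolding null by simp
  next
    case False
    then have pos: "0 < Gam L u u x" using Gam_nonneg[OF u, of x] by simp
    have "I \<le> ereal (1 / Gam L u u x * Q u)"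
      unfolding I_def using pos by (intro INF_lower) simp
    then have "ereal K + I \<le> ereal (K + 1 / Gam L u u x * Q u)"
      by (metis add_left_mono plus_ereal.simps(1))
    then have "(ereal K + I) * ereal ((f x)\<^sup>2 * Gam L u u x)
        \<le> ereal (K + 1 / Gam L u u x * Q u) * ereal ((f x)\<^sup>2 * Gam L u u x)"
      using pos by (intro ereal_mult_right_mono) auto
    also have "\<dots> = ereal ((f x)\<^sup>2 * (K * Gam L u u x + Q u))"
      using pos by (simp add: field_simps)
    finally show ?thesis .
  qed
  then have "(ereal K + I) * ereal ((f x)\<^sup>2 * Gam L u u x) + ereal (1 / N * (conformal L f N u x)\<^sup>2)
      \<le> ereal ((f x)\<^sup>2 * (K * Gam L u u x + Q u)) + ereal (1 / N * (conformal L f N u x)\<^sup>2)"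
    by (rule add_right_mono)
  also have "\<dots> \<le> ereal (Gam2 (conformal L f N) u u x)" using bound by simp
  finally show "(ereal ((f x)\<^sup>2 * k x + 1/2 * L (\<lambda>y. (f y)\<^sup>2) x - N * Gam L f f x)
       + (INF u \<in> {u \<in> A. Gam L u u x > 0}.
            ereal (1 / Gam L u u x * (- (N - 2) * (Gam L f u x)\<^sup>2
                     + (N - 2)/2 * Hess L (\<lambda>y. (f y)\<^sup>2) u u x))))
       * ereal (Gam (conformal L f N) u u x) + ereal (1 / N * (conformal L f N u x)\<^sup>2)
      \<le> ereal (Gam2 (conformal L f N) u u x)"
    by (simp add: K_def Q_def I_def w_def Gam_conformal)
qed

end

text \<open>The two forms of the curvature function agree because \<open>L f\<^sup>2 = 2 f L f + 2 \<Gamma>(f)\<close> and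
  \<open>H\<^bsub>f\<^sup>2\<^esub>(u, u) = 2 \<Gamma>(f, u)\<^sup>2 + 2 f H\<^sub>f(u, u)\<close>.\<close>
theorem corollary7p1:
  fixes A :: "('a \<Rightarrow> real) set"
    and L :: "('a \<Rightarrow> real) \<Rightarrow> 'a \<Rightarrow> real"
    and f :: "'a \<Rightarrow> real"
    and N :: real
  assumes "diffusion_operator A L"
    and "f \<in> A"
    and "1 \<le> N"
  shows "(\<forall>u\<in>A. \<forall>x.
            Ricci A (conformal L f N) N u x \<ge>
              ereal ((f x)^4) * Ricci A L N u x
              + ereal ((1/2 * (f x)\<^sup>2 * L (\<lambda>y. (f y)\<^sup>2) x
                         - N/4 * Gam L (\<lambda>y. (f y)\<^sup>2) (\<lambda>y. (f y)\<^sup>2) x) * Gam L u u x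
                       - (N - 2)/4 * (Gam L (\<lambda>y. (f y)\<^sup>2) u x)\<^sup>2
                       + (N - 2)/2 * (f x)\<^sup>2 * Hess L (\<lambda>y. (f y)\<^sup>2) u u x))
       \<and> (\<forall>k :: 'a \<Rightarrow> real. BE A L (\<lambda>x. ereal (k x)) N \<longrightarrow>
            (let k' = (\<lambda>x. ereal ((f x)\<^sup>2 * k x + 1/2 * L (\<lambda>y. (f y)\<^sup>2) x - N * Gam L f f x)
                        + (INF u \<in> {u \<in> A. Gam L u u x > 0}.
                             ereal (1 / Gam L u u x *
                               (- (N - 2) * (Gam L f u x)\<^sup>2
                                + (N - 2)/2 * Hess L (\<lambda>y. (f y)\<^sup>2) u u x))))
             in BE A (conformal L f N) k' N \<and>
                k' = (\<lambda>x. ereal ((f x)\<^sup>2 * k x + f x * L f x - (N - 1) * Gam L f f x)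
                        + (INF u \<in> {u \<in> A. Gam L u u x > 0}.
                             ereal ((N - 2) / Gam L u u x * f x * Hess L f u u x)))))"
proof -
  interpret diffusion_operator A L by fact
  have N: "N \<noteq> 0" using assms(3) by simp
  have "ereal ((f x)^4) * Ricci A L N u x
        + ereal ((1/2 * (f x)\<^sup>2 * L (\<lambda>y. (f y)\<^sup>2) x
                   - N/4 * Gam L (\<lambda>y. (f y)\<^sup>2) (\<lambda>y. (f y)\<^sup>2) x) * Gam L u u x
                 - (N - 2)/4 * (Gam L (\<lambda>y. (f y)\<^sup>2) u x)\<^sup>2
                 + (N - 2)/2 * (f x)\<^sup>2 * Hess L (\<lambda>y. (f y)\<^sup>2) u u x)
        \<le> Ricci A (conformal L f N) N u x" if "u \<in> A" for u x
    using Ricci_conformal_lower_bound[OF assms(2) that N, of x]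
    by (simp flip: power_mult)
  moreover have "(\<lambda>x. ereal ((f x)\<^sup>2 * k x + 1/2 * L (\<lambda>y. (f y)\<^sup>2) x - N * Gam L f f x)
            + (INF u \<in> {u \<in> A. Gam L u u x > 0}.
                 ereal (1 / Gam L u u x *
                   (- (N - 2) * (Gam L f u x)\<^sup>2
                    + (N - 2)/2 * Hess L (\<lambda>y. (f y)\<^sup>2) u u x)))) =
        (\<lambda>x. ereal ((f x)\<^sup>2 * k x + f x * L f x - (N - 1) * Gam L f f x)
            + (INF u \<in> {u \<in> A. Gam L u u x > 0}.
                 ereal ((N - 2) / Gam L u u x * f x * Hess L f u u x)))" for k :: "'a \<Rightarrow> real"
    by (intro ext arg_cong2[of _ _ _ _ "(+)"] INF_cong refl arg_cong[of _ _ ereal])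
      (simp_all add: L_square Hess_square assms(2) field_simps)
  ultimately show ?thesis
    using BE_conformal[OF _ assms(2) N] unfolding Let_def by (intro conjI ballI allI impI)
qed

end
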